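(* Let $r_1,r_2\in\mathbb{N}$. If $r_1\nmid r_2$ and $r_2\nmid r_1$, then the classes $GM(\beta^{\ast},r_1)$ and $GM(\beta^{\ast},r_2)$ are not comparable, i.e. $GM(\beta^{\ast},r_1)\not\subseteq GM(\beta^{\ast},r_2)$ and $GM(\beta^{\ast},r_2)\not\subseteq GM(\beta^{\ast},r_1)$.
   Context: $\mathbb{N}=\{1,2,3,\dots\}$ and $[x]$ denotes the integer part of $x$. Sequences $a=(a_n)_{n\ge 1}$ are sequences of complex numbers indexed by the positive integers. For $r\in\mathbb{N}$, the class $GM(\beta^{\ast},r)$ is the set of all complex sequences $a=(a_n)$ for which there exist a real number $c>1$ and a constant $K(a)$ (both may depend on the sequence $a$, but not on $m$) such that for all $m\in\mathbb{N}$ $$\sum_{n=m}^{2m-1}|a_n-a_{n+r}|\le K(a)\,\beta^{\ast}_m,\qquad \beta^{\ast}_m=\sum_{k=m}^{m+r-1}|a_k|+\sum_{k=[m/c]}^{[cm]}\frac{|a_k|}{k}.$$ In the last sum only indices $k\ge 1$ are taken (i.e. if $[m/c]=0$ the sum starts at $k=1$). *)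

theory Defs
  imports Complex_Main
begin

text \<open>
  A sequence indexed by the positive integers is a function on \<^typ>\<open>nat\<close> whose value at
  \<open>0\<close> is never read: every sum below runs over indices \<open>\<ge> 1\<close>
  (see \<open>GM_beta_star_cong\<close>).

  The majorant depends on the parameter \<open>c\<close>, which is chosen per sequence in
  \<open>GM_beta_star\<close>. Integer parts are taken of nonnegative reals, so the conversion \<open>nat\<close> loses
  nothing; \<open>max 1\<close> lets the second sum start at \<open>k = 1\<close> when \<open>m < c\<close>.
\<close>

definition beta_star :: "nat \<Rightarrow> real \<Rightarrow> (nat \<Rightarrow> complex) \<Rightarrow> nat \<Rightarrow> real" where
  "beta_star r c a m =
     (\<Sum>k = m..m + r - 1. cmod (a k)) +
     (\<Sum>k = max 1 (nat \<lfloor>real m / c\<rfloor>)..nat \<lfloor>c * real m\<rfloor>. cmod (a k) / real k)"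

definition GM_beta_star :: "nat \<Rightarrow> (nat \<Rightarrow> complex) set" where
  "GM_beta_star r =
     {a. \<exists>c > 1. \<exists>K :: real. \<forall>m \<ge> 1.
           (\<Sum>n = m..2 * m - 1. cmod (a n - a (n + r))) \<le> K * beta_star r c a m}"

lemma beta_star_cong:
  assumes "\<And>n. n \<ge> 1 \<Longrightarrow> a n = b n" and "m \<ge> 1"
  shows "beta_star r c a m = beta_star r c b m"
  unfolding beta_star_def using assms by (intro arg_cong2[where f = "(+)"] sum.cong) auto

lemma GM_beta_star_cong:
  assumes "\<And>n. n \<ge> 1 \<Longrightarrow> a n = b n"
  shows "a \<in> GM_beta_star r \<longleftrightarrow> b \<in> GM_beta_star r"
proof -
  have "(\<Sum>n = m..2 * m - 1. cmod (a n - a (n + r))) =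
        (\<Sum>n = m..2 * m - 1. cmod (b n - b (n + r)))" if "m \<ge> 1" for m
    using assms that by (intro sum.cong) auto
  then show ?thesis
    unfolding GM_beta_star_def by (simp add: beta_star_cong[OF assms] cong: conj_cong)
qed

end

theory Submission
  imports Defs
begin

text \<open>
  The indicator sequence of the multiples of \<open>r\<close> is \<open>r\<close>-periodic, so it lies in the class for
  \<open>r\<close> trivially. Its majorant is bounded, since \<open>1 / k\<close> sums to \<open>O(1)\<close> over a
  range \<open>[m / c, c m]\<close>. If \<open>r\<close> does not divide \<open>s\<close>, then every multiple of \<open>r\<close> contributes
  1 to the sum of \<open>s\<close>-step differences, which therefore grows linearly in \<open>m\<close>.
\<close>

text \<open>Counting suffices for the weighted sum: its range has at most \<open>c * m\<close>
  indices, and each term is at most \<open>2 * c / m\<close> because the lower end is at least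
  \<open>m / (2 * c)\<close>.\<close>

lemma beta_star_bounded:
  assumes "\<And>k. cmod (a k) \<le> 1" and "c > 1" and "m \<ge> 1"
  shows "beta_star s c a m \<le> real s + 2 * c\<^sup>2"
proof -
  define L where "L = max 1 (nat \<lfloor>real m / c\<rfloor>)"
  define U where "U = nat \<lfloor>c * real m\<rfloor>"
  have "(\<Sum>k = m..m + s - 1. cmod (a k)) \<le> (\<Sum>k = m..m + s - 1. 1)"
    by (intro sum_mono assms(1))
  also have "\<dots> \<le> real s"
    using \<open>m \<ge> 1\<close> by simp
  finally have first: "(\<Sum>k = m..m + s - 1. cmod (a k)) \<le> real s" .
  have L: "real m / (2 * c) \<le> real L"
  proof -
    have "real m / c - 1 < real (nat \<lfloor>real m / c\<rfloor>)"
      using \<open>c > 1\<close> by linarith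
    \<comment> \<open>The floor loses less than 1 and \<open>L \<ge> 1\<close>, so
      \<open>2 * L \<ge> L + 1 > m / c\<close>.\<close>
    then have "real m / c \<le> 2 * real L"
      unfolding L_def by (simp add: max_def)
    then show ?thesis
      by (simp add: mult.commute)
  qed
  have pos: "real m / (2 * c) > 0"
    using assms by simp
  have "cmod (a k) / real k \<le> 2 * c / real m" if "k \<in> {L..U}" for k
  proof -
    have "cmod (a k) / real k \<le> 1 / (real m / (2 * c))"
      using L pos that assms(1)[of k] by (intro frac_le) auto
    then show ?thesis
      by simp
  qed
  then have "(\<Sum>k = L..U. cmod (a k) / real k) \<le> real (card {L..U}) * (2 * c / real m)"
    by (intro sum_bounded_above)
  also have "\<dots> \<le> (c * real m) * (2 * c / real m)"
  proof (rule mult_right_mono)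
    \<comment> \<open>Index 0 is excluded since \<open>L \<ge> 1\<close>.\<close>
    have "card {L..U} \<le> U"
      unfolding L_def by simp
    also have "real U \<le> c * real m"
      unfolding U_def using assms by simp
    finally show "real (card {L..U}) \<le> c * real m"
      by simp
  qed (use assms in simp)
  also have "\<dots> = 2 * c\<^sup>2"
    using \<open>m \<ge> 1\<close> by (simp add: power2_eq_square)
  finally show ?thesis
    using first unfolding beta_star_def L_def U_def by simp
qed

lemma beta_star_nonneg: "beta_star s c a m \<ge> 0"
  unfolding beta_star_def by (intro add_nonneg_nonneg sum_nonneg) auto

lemma periodic_in_GM_beta_star:
  assumes "\<And>n. a (n + r) = a n"
  shows "a \<in> GM_beta_star r"
proof -
  \<comment> \<open>All differences vanish, so \<open>K = 0\<close> works; \<open>c = 2\<close> is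
    an arbitrary choice.\<close>
  have "\<forall>m \<ge> 1. (\<Sum>n = m..2 * m - 1. cmod (a n - a (n + r))) \<le> 0 * beta_star r 2 a m"
    unfolding assms by simp
  then show ?thesis
    unfolding GM_beta_star_def mem_Collect_eq by (intro exI[of _ 2] conjI exI[of _ 0]) simp
qed

lemma GM_beta_star_not_subset:
  assumes "\<not> r dvd s" and "r \<ge> 1"
  shows "\<not> GM_beta_star r \<subseteq> GM_beta_star s"
proof
  define a :: "nat \<Rightarrow> complex" where "a n = of_bool (r dvd n)" for n
  have "a \<in> GM_beta_star r"
    by (rule periodic_in_GM_beta_star) (simp add: a_def)
  moreover assume "GM_beta_star r \<subseteq> GM_beta_star s"
  ultimately have "a \<in> GM_beta_star s"
    by blast
  then obtain c K where "c > 1" and le: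
    "\<And>m. m \<ge> 1 \<Longrightarrow> (\<Sum>n = m..2 * m - 1. cmod (a n - a (n + s))) \<le> K * beta_star s c a m"
    unfolding GM_beta_star_def by auto
  \<comment> \<open>The sign of \<open>K\<close> is unknown; \<open>\<bar>K\<bar>\<close> keeps the
    product monotone in the majorant.\<close>
  define B where "B = \<bar>K\<bar> * (real s + 2 * c\<^sup>2)"
  obtain N :: nat where "N \<ge> 1" and N: "real N > B"
    by (metis reals_Archimedean2 less_le_trans linear of_nat_le_iff)
  \<comment> \<open>The window from \<open>m\<close> to \<open>2 * m - 1\<close> then contains the
    \<open>N\<close> multiples \<open>r * j\<close> with \<open>N \<le> j < 2 * N\<close>.\<close>
  define m where "m = r * N"
  have "m \<ge> 1"
    using \<open>N \<ge> 1\<close> \<open>r \<ge> 1\<close> unfolding m_def by simp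
  have multiples: "(\<lambda>j. r * j) ` {N..<2 * N} \<subseteq> {m..2 * m - 1}"
  proof (rule image_subsetI)
    fix j assume "j \<in> {N..<2 * N}"
    then have "r * N \<le> r * j" and "r * j < r * (2 * N)"
      using \<open>r \<ge> 1\<close> by simp_all
    moreover have "r * (2 * N) = 2 * m"
      unfolding m_def by simp
    ultimately have "m \<le> r * j" and "r * j \<le> 2 * m - 1"
      unfolding m_def by linarith+
    then show "r * j \<in> {m..2 * m - 1}"
      by simp
  qed
  \<comment> \<open>Each term is \<open>1 - 0\<close>: \<open>r\<close> divides
    \<open>r * j + s\<close> only if it divides \<open>s\<close>.\<close>
  have "real N = (\<Sum>j \<in> {N..<2 * N}. cmod (a (r * j) - a (r * j + s)))"
    using assms by (simp add: a_def dvd_add_right_iff)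
  also have "\<dots> = (\<Sum>n \<in> (\<lambda>j. r * j) ` {N..<2 * N}. cmod (a n - a (n + s)))"
    using \<open>r \<ge> 1\<close> by (subst sum.reindex) (auto simp: inj_on_def)
  also have "\<dots> \<le> (\<Sum>n = m..2 * m - 1. cmod (a n - a (n + s)))"
    by (intro sum_mono2 multiples) auto
  also have "\<dots> \<le> K * beta_star s c a m"
    by (rule le) fact
  also have "\<dots> \<le> B"
    unfolding B_def using \<open>c > 1\<close> \<open>m \<ge> 1\<close>
    by (intro mult_mono beta_star_bounded beta_star_nonneg) (auto simp: a_def)
  finally show False
    using N by simp
qed

theorem theorem3:
  fixes r1 r2 :: nat
  assumes "r1 \<ge> 1" and "r2 \<ge> 1"
    and "\<not> r1 dvd r2" and "\<not> r2 dvd r1"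
  shows "\<not> GM_beta_star r1 \<subseteq> GM_beta_star r2 \<and> \<not> GM_beta_star r2 \<subseteq> GM_beta_star r1"
  using assms by (simp add: GM_beta_star_not_subset)

end
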